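(* For every integer $r\geq2$, $$W_r(n)\sim\frac{A_r}{n^r},\qquad n\to\infty,\qquad\text{where } A_r:=\sum_{m=0}^\infty W_r(m).$$
   Context: The cycle structure of a permutation of $n$ letters is the partition $\lambda=(\lambda_1,\dots,\lambda_n)$ of $n$ (nonnegative integers with $\sum_j j\lambda_j=n$) where $\lambda_j$ is the number of cycles of length $j$. $W_r(n)$ is the probability that $r$ uniformly random independent permutations of $n$ letters have the same cycle structure, for $n\geq1$; $W_r(0):=1$. *)

theory Defs
  imports
    "HOL-Combinatorics.Orbits"
    "HOL-Probability.Product_PMF"
    "HOL-Library.Landau_Symbols"
begin

text \<open>
  A cycle of \<open>p\<close> is identified with the orbit it permutes; a fixed point is a cycle of length 1.
  The list is \<open>(\<lambda>\<^sub>1, \<dots>, \<lambda>\<^sub>n)\<close>, so \<open>\<lambda>\<^sub>j\<close> is at list position \<open>j - 1\<close>.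
\<close>
definition cycle_structure :: "nat \<Rightarrow> (nat \<Rightarrow> nat) \<Rightarrow> nat list" where
  "cycle_structure n p =
     map (\<lambda>j. card {C \<in> orbit p ` {1..n}. card C = j}) [1..<Suc n]"

definition random_perms :: "nat \<Rightarrow> nat \<Rightarrow> (nat \<Rightarrow> nat \<Rightarrow> nat) pmf" where
  "random_perms r n = Pi_pmf {..<r} id (\<lambda>_. pmf_of_set {p. p permutes {1..n}})"

definition W :: "nat \<Rightarrow> nat \<Rightarrow> real" where
  "W r n = (if n = 0 then 1 else
     measure_pmf.prob (random_perms r n)
       {\<sigma>. \<forall>i<r. \<forall>k<r. cycle_structure n (\<sigma> i) = cycle_structure n (\<sigma> k)})"

end

theory Submission
  imports Defs "HOL-Real_Asymp.Real_Asymp"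
begin

text \<open>
  By Cauchy's formula, \<open>W\<^sub>r(n)\<close> is the sum of \<open>w(\<lambda>)\<^sup>r\<close> over the partitions \<open>\<lambda>\<close> of \<open>n\<close>, where
  \<open>w(\<lambda>) = \<Prod>\<^sub>j 1 / (j ^ \<lambda>\<^sub>j \<lambda>\<^sub>j!)\<close>, so \<open>\<Sum>\<^sub>n W\<^sub>r(n) \<rho> ^ n\<close> is dominated coefficientwise by
  \<open>exp (\<Sum>\<^sub>j \<rho> ^ j / j ^ r)\<close>. Partitions with a part \<open>n - m > n / 2\<close> contribute
  \<open>\<Sum>\<^sub>m W\<^sub>r(m) / (n - m) ^ r\<close>, which is asymptotic to \<open>A\<^sub>r / n ^ r\<close> by dominated convergence.
  Partitions with a part in \<open>(K, n / 2]\<close>, where \<open>K = n / (2 (r + 1))\<close>, contribute at most \<open>K ^ -r\<close>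
  times a tail of the convergent series \<open>A\<^sub>r\<close>. Partitions with all parts at most \<open>K\<close> contribute
  \<open>O(n ^ -(r + 1))\<close> by Rankin's trick.
\<close>

subsection \<open>Inserting a point into a cycle\<close>

text \<open>\<open>mset_set\<close> is applied to the set of orbits, so each cycle counts once and
  not once per point. A multiset turns lengthening a cycle into replacing one element, with no
  dependence on the size of \<open>S\<close>.\<close>

definition cycle_type :: "'a set \<Rightarrow> ('a \<Rightarrow> 'a) \<Rightarrow> nat multiset" where
  "cycle_type S p = image_mset card (mset_set (orbit p ` S))"

lemma orbit_eq_of_mem:
  assumes "permutation p" "y \<in> orbit p x"
  shows "orbit p y = orbit p x"
  using assms by (meson orbit_swap orbit_trans permutation_self_in_orbit subsetI subset_antisym)

text \<open>The composite sends the \<open>q\<close>-preimage of \<open>b\<close> to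
  \<open>a\<close> and \<open>a\<close> to \<open>b\<close>, and agrees with \<open>q\<close>
  elsewhere: it inserts \<open>a\<close> into the cycle of \<open>b\<close> just before
  \<open>b\<close>.\<close>

lemma orbit_transpose_comp:
  assumes q: "q permutes S" and S: "finite S" and a: "a \<notin> S" and b: "b \<in> S"
  shows "orbit (Transposition.transpose a b \<circ> q) b = insert a (orbit q b)"
proof -
  let ?p = "Transposition.transpose a b \<circ> q"
  have "q permutes insert a S" by (rule permutes_subset[OF q]) auto
  then have "?p permutes insert a S"
    by (rule permutes_compose) (use b in \<open>auto intro: permutes_swap_id\<close>)
  then have perm: "permutation ?p" using S by (auto simp: permutation_permutes)
  have qa: "q a = a" using permutes_not_in[OF q a] .
  have sub: "orbit q b \<subseteq> S" by (rule permutes_orbit_subset[OF q b])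
  have pb: "b \<in> orbit ?p b" by (rule permutation_self_in_orbit[OF perm])
  have qb: "b \<in> orbit q b"
    using q S by (intro permutation_self_in_orbit) (auto simp: permutation_permutes)
  have p_eq_q: "?p y = q y" if "y \<in> S" "q y \<noteq> b" for y
    using that a permutes_in_image[OF q, of y] by (auto simp: Transposition.transpose_def)
  show ?thesis
  proof (intro equalityI subsetI)
    fix x assume "x \<in> orbit ?p b"
    then show "x \<in> insert a (orbit q b)"
    proof induction
      case base show ?case using qb by (auto simp: Transposition.transpose_def intro: orbit.base)
    next
      case (step y)
      show ?case using qb step.IH qa
        by (auto simp: Transposition.transpose_def intro: orbit.step)
    qed
  next
    fix x assume "x \<in> insert a (orbit q b)"
    moreover have "a \<in> orbit ?p b"
      using permutation_orbit_step[OF perm, of a] permutation_self_in_orbit[OF perm, of a] qa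
      by simp
    \<comment> \<open>Walking along the \<open>q\<close>-cycle, the two maps differ only at the step
      that leads to \<open>b\<close>, and \<open>b\<close> is known to lie in its own orbit.\<close>
    moreover have "x \<in> orbit ?p b" if "x \<in> orbit q b" using that
    proof induction
      case base show ?case
        using pb p_eq_q[OF b] orbit.base[of ?p b] by (cases "q b = b") (simp_all add: comp_def)
    next
      case (step y)
      then have "y \<in> S" using sub by auto
      then show ?case
        using pb p_eq_q[of y] orbit.step[OF step.IH] by (cases "q y = b") (simp_all add: comp_def)
    qed
    ultimately show "x \<in> orbit ?p b" by auto
  qed
qed

text \<open>A \<open>q\<close>-orbit other than that of \<open>b\<close> contains neither
  \<open>a\<close> nor \<open>b\<close>, so the transposition does not act on it and it remains an
  orbit.\<close>

lemma orbits_transpose_comp: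
  assumes q: "q permutes S" and S: "finite S" and a: "a \<notin> S" and b: "b \<in> S"
  shows "orbit (Transposition.transpose a b \<circ> q) ` insert a S =
           insert (insert a (orbit q b)) (orbit q ` S - {orbit q b})"
proof -
  let ?p = "Transposition.transpose a b \<circ> q"
  have "q permutes insert a S" by (rule permutes_subset[OF q]) auto
  then have "?p permutes insert a S"
    by (rule permutes_compose) (use b in \<open>auto intro: permutes_swap_id\<close>)
  then have perm: "permutation ?p" using S by (auto simp: permutation_permutes)
  have permq: "permutation q" using q S by (auto simp: permutation_permutes)
  have on: "orbit ?p x = insert a (orbit q b)" if "x \<in> insert a (orbit q b)" for x
    using orbit_eq_of_mem[OF perm, of x b] orbit_transpose_comp[OF assms] that by auto
  have off: "orbit ?p x = orbit q x" if x: "x \<in> S" "x \<notin> orbit q b" for x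
  proof (rule orbit_cong0[of x "orbit q x"])
    show "x \<in> orbit q x" by (rule permutation_self_in_orbit[OF permq])
    have *: "?p y = q y" if y: "y \<in> orbit q x" for y
    proof -
      have "q y \<in> orbit q x" using y by (rule orbit.step)
      moreover from this have "q y \<in> S" using permutes_orbit_subset[OF q x(1)] by auto
      moreover have "b \<notin> orbit q x" using orbit_eq_of_mem[OF permq, of b x] x
        permutation_self_in_orbit[OF permq, of x] by auto
      ultimately show ?thesis using a by (auto simp: Transposition.transpose_def)
    qed
    then show "?p \<in> orbit q x \<rightarrow> orbit q x" by (auto intro: orbit.step)
    show "?p y = q y" if "y \<in> orbit q x" for y using * that .
  qed
  have sub: "orbit q b \<subseteq> S" by (rule permutes_orbit_subset[OF q b])
  have eq: "orbit q x = orbit q b \<longleftrightarrow> x \<in> orbit q b" for x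
    using orbit_eq_of_mem[OF permq, of x b] permutation_self_in_orbit[OF permq, of x] by auto
  have "insert a S = insert a (orbit q b) \<union> (S - orbit q b)" using sub by auto
  then have "orbit ?p ` insert a S = orbit ?p ` insert a (orbit q b) \<union> orbit ?p ` (S - orbit q b)"
    by (metis image_Un)
  also have "orbit ?p ` insert a (orbit q b) = {insert a (orbit q b)}"
    using on by (auto simp del: o_apply)
  also have "orbit ?p ` (S - orbit q b) = orbit q ` (S - orbit q b)"
    using off by (intro image_cong) auto
  also have "\<dots> = orbit q ` S - {orbit q b}" using eq by auto
  finally show ?thesis by (simp add: comp_def)
qed

text \<open>The enlarged orbit contains \<open>a\<close> and is therefore distinct from every old
  orbit; so exactly one length changes, from \<open>j\<close> to \<open>j + 1\<close>.\<close>

lemma cycle_type_transpose_comp: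
  assumes q: "q permutes S" and S: "finite S" and a: "a \<notin> S" and b: "b \<in> S"
  shows "cycle_type (insert a S) (Transposition.transpose a b \<circ> q) =
           add_mset (Suc (card (orbit q b))) (cycle_type S q - {#card (orbit q b)#})"
proof -
  have sub: "orbit q x \<subseteq> S" if "x \<in> S" for x by (rule permutes_orbit_subset[OF q that])
  have "a \<notin> orbit q b" "finite (orbit q b)" using sub[OF b] a S finite_subset by auto
  moreover have "insert a (orbit q b) \<notin> orbit q ` S - {orbit q b}" using sub a by auto
  ultimately show ?thesis unfolding cycle_type_def orbits_transpose_comp[OF assms] 
    using S b by (simp add: mset_set_Diff image_mset_Diff)
qed

lemma cycle_type_insert_fixpoint:
  assumes q: "q permutes S" and S: "finite S" and a: "a \<notin> S"
  shows "cycle_type (insert a S) q = add_mset 1 (cycle_type S q)"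
proof -
  have "orbit q a = {a}" using permutes_not_in[OF q a] by (simp add: orbit_eq_singleton_iff)
  moreover have "{a} \<notin> orbit q ` S" using permutes_orbit_subset[OF q] a by fastforce
  ultimately show ?thesis using S by (simp add: cycle_type_def)
qed

text \<open>Group the points by their orbit: a cycle of length \<open>j\<close> holds
  \<open>j\<close> points. This counts insertion places, and with constant \<open>g = 1\<close> it
  shows that the cycle lengths add up to \<open>card S\<close>.\<close>

lemma sum_over_cycles:
  fixes g :: "nat \<Rightarrow> 'b::semiring_1"
  assumes q: "q permutes S" and S: "finite S"
  shows "(\<Sum>b\<in>S. g (card (orbit q b))) = (\<Sum>j\<in>#cycle_type S q. of_nat j * g j)"
proof -
  have permq: "permutation q" using q S by (auto simp: permutation_permutes)
  have "(\<Sum>b\<in>S. g (card (orbit q b))) =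
          (\<Sum>C\<in>orbit q ` S. \<Sum>b\<in>{b\<in>S. orbit q b = C}. g (card (orbit q b)))"
    by (rule sum.image_gen[OF S])
  also have "\<dots> = (\<Sum>C\<in>orbit q ` S. of_nat (card C) * g (card C))"
  proof (rule sum.cong[OF refl])
    fix C assume "C \<in> orbit q ` S"
    then have "{b\<in>S. orbit q b = C} = C"
      using orbit_eq_of_mem[OF permq] permutation_self_in_orbit[OF permq] permutes_orbit_subset[OF q]
      by blast
    moreover have "(\<Sum>b\<in>{b\<in>S. orbit q b = C}. g (card (orbit q b))) =
                     (\<Sum>b\<in>{b\<in>S. orbit q b = C}. g (card C))"
      by (rule sum.cong) auto
    ultimately show "(\<Sum>b\<in>{b\<in>S. orbit q b = C}. g (card (orbit q b))) = of_nat (card C) * g (card C)"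
      by simp
  qed
  finally show ?thesis by (simp add: cycle_type_def sum_unfold_sum_mset image_mset.compositionality o_def)
qed

subsection \<open>Cauchy's formula\<close>

lemma sum_mset_eq_sum_count:
  fixes f :: "'a \<Rightarrow> 'b::comm_semiring_1"
  assumes "finite A" "set_mset M \<subseteq> A"
  shows "(\<Sum>x\<in>#M. f x) = (\<Sum>x\<in>A. of_nat (count M x) * f x)"
  using assms(2)
proof (induction M)
  case (add y M)
  have "(\<Sum>x\<in>A. of_nat (count (add_mset y M) x) * f x) =
        (\<Sum>x\<in>A. (if x = y then f x else 0) + of_nat (count M x) * f x)"
    by (intro sum.cong) (auto simp: algebra_simps)
  also have "\<dots> = f y + (\<Sum>x\<in>A. of_nat (count M x) * f x)"
    using add.prems assms(1) by (simp add: sum.distrib)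
  finally show ?case using add by simp
qed auto

text \<open>For a partition, this is the reciprocal of the order of the centralizer of a permutation
  of that cycle type, hence the probability of the type.\<close>

definition cycle_weight :: "nat multiset \<Rightarrow> real" where
  "cycle_weight M = (\<Prod>j\<in>set_mset M. 1 / (real j ^ count M j * fact (count M j)))"

text \<open>Absent parts contribute the factor 1, so different multisets can share one index
  set.\<close>

lemma cycle_weight_superset:
  assumes "finite A" "set_mset M \<subseteq> A"
  shows "cycle_weight M = (\<Prod>j\<in>A. 1 / (real j ^ count M j * fact (count M j)))"
  unfolding cycle_weight_def using assms
  by (intro prod.mono_neutral_left) (auto simp: not_in_iff)

lemma cycle_weight_add_mset:
  "cycle_weight (add_mset j M) = cycle_weight M / (real j * real (Suc (count M j)))"
proof -
  let ?A = "insert j (set_mset M)" and ?g = "\<lambda>M j. 1 / (real j ^ count M j * fact (count M j))"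
  have "cycle_weight (add_mset j M) = ?g (add_mset j M) j * (\<Prod>i\<in>?A - {j}. ?g (add_mset j M) i)"
    by (subst cycle_weight_superset[of ?A], simp, simp, subst prod.remove[of _ j]) auto
  also have "(\<Prod>i\<in>?A - {j}. ?g (add_mset j M) i) = (\<Prod>i\<in>?A - {j}. ?g M i)"
    by (intro prod.cong) auto
  also have "?g (add_mset j M) j = ?g M j / (real j * real (Suc (count M j)))"
    by (simp add: field_simps)
  also have "?g M j / (real j * real (Suc (count M j))) * (\<Prod>i\<in>?A - {j}. ?g M i) =
             ?g M j * (\<Prod>i\<in>?A - {j}. ?g M i) / (real j * real (Suc (count M j)))"
    by simp
  also have "?g M j * (\<Prod>i\<in>?A - {j}. ?g M i) = cycle_weight M"
    by (subst cycle_weight_superset[of ?A M], simp, blast, subst prod.remove[of ?A j]) auto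
  finally show ?thesis .
qed

lemma cycle_weight_remove:
  assumes "j \<in># M" "j > 0"
  shows "cycle_weight (M - {#j#}) = cycle_weight M * (real j * real (count M j))"
proof -
  obtain N where N: "M = add_mset j N" using multi_member_split[OF assms(1)] by auto
  then show ?thesis using assms(2) by (simp add: cycle_weight_add_mset del: of_nat_Suc)
qed

text \<open>Removing a point \<open>a\<close> from its cycle either deletes a fixed point or shortens one cycle
  by 1, and a cycle of length \<open>j\<close> arises in \<open>j\<close> ways; the weights satisfy the same recursion.\<close>
lemma card_permutes_cycle_type:
  assumes "finite S" "0 \<notin># M" "sum_mset M = card S"
  shows "real (card {p. p permutes S \<and> cycle_type S p = M}) = fact (card S) * cycle_weight M"
proof -
  \<comment> \<open>Counting by a sum of indicators allows the sums over permutations, points and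
    lengths to be interchanged.\<close>
  define N where "N S M = (\<Sum>p | p permutes S. of_bool (cycle_type S p = M) :: real)"
    for S :: "'a set" and M
  have "N S M = fact (card S) * cycle_weight M" using assms
  proof (induction S arbitrary: M rule: finite_induct)
    case empty
    then have "M = {#}" by (cases M) auto
    then show ?case by (simp add: N_def cycle_type_def cycle_weight_def)
  next
    case (insert a S)
    let ?P = "{q. q permutes S}"
    \<comment> \<open>The lengths \<open>j\<close> that a cycle can have before it grows into a part
      \<open>j + 1\<close> of \<open>M\<close>. The part 1 comes from a new fixed point instead,
      hence \<open>j > 0\<close>.\<close>
    define J where "J = {j. j > 0 \<and> Suc j \<in># M}"
    have JM: "Suc ` J \<subseteq> set_mset M" by (auto simp: J_def)
    then have finJ: "finite J"
      by (metis finite_imageD finite_set_mset finite_subset inj_Suc)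
    have card: "sum_mset M = Suc (card S)" using insert by simp

    \<comment> \<open>The case \<open>b = a\<close>: the transposition is the identity and
      \<open>a\<close> becomes a fixed point.\<close>
    have "(\<Sum>q\<in>?P. of_bool (cycle_type (insert a S) (Transposition.transpose a a \<circ> q) = M)) =
          (\<Sum>q\<in>?P. of_bool (add_mset 1 (cycle_type S q) = M) :: real)"
      using cycle_type_insert_fixpoint[OF _ insert.hyps] by (intro sum.cong) auto
    also have "\<dots> = fact (card S) * cycle_weight M * real (count M 1)"
    proof (cases "1 \<in># M")
      case True
      then have "add_mset 1 X = M \<longleftrightarrow> X = M - {#1#}" for X
        by (metis add_mset_remove_trivial insert_DiffM)
      then have "(\<Sum>q\<in>?P. of_bool (add_mset 1 (cycle_type S q) = M) :: real) = N S (M - {#1#})"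
        by (simp add: N_def)
      also have "\<dots> = fact (card S) * cycle_weight (M - {#1#})"
      proof (rule insert.IH)
        show "0 \<notin># M - {#1#}" using insert.prems(1) by (meson in_diffD)
        show "sum_mset (M - {#1#}) = card S" using True card by (simp add: sum_mset_diff)
      qed
      finally show ?thesis using True by (simp add: cycle_weight_remove)
    next
      case False
      then have "add_mset 1 X \<noteq> M" for X by auto
      then show ?thesis using False by (simp add: not_in_iff)
    qed
    finally have fixed: "(\<Sum>q\<in>?P. of_bool (cycle_type (insert a S) (Transposition.transpose a a \<circ> q) = M)) =
       fact (card S) * cycle_weight M * real (count M 1)" .

    \<comment> \<open>Inserting \<open>a\<close> before \<open>b\<close> gives type \<open>M\<close>
      iff \<open>q\<close> has type \<open>M\<close> with one part \<open>j + 1\<close> replaced by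
      \<open>j\<close>, where \<open>j\<close> is the length of the cycle of \<open>b\<close>. Such
      a \<open>q\<close> has \<open>count M j + 1\<close> cycles of length \<open>j\<close>, each
      with \<open>j\<close> choices of \<open>b\<close>.\<close>
    have inner: "(\<Sum>b\<in>S. of_bool (cycle_type (insert a S) (Transposition.transpose a b \<circ> q) = M) :: real) =
       (\<Sum>j\<in>J. real j * real (Suc (count M j)) * of_bool (cycle_type S q = add_mset j (M - {#Suc j#})))"
      (is "?lhs = ?rhs") if q: "q permutes S" for q
    proof -
      let ?N = "cycle_type S q"
      let ?h = "\<lambda>j. real (count ?N j) * (real j * of_bool (add_mset (Suc j) (?N - {#j#}) = M))"
      have "?lhs = (\<Sum>b\<in>S. of_bool (add_mset (Suc (card (orbit q b))) (?N - {#card (orbit q b)#}) = M))"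
        using cycle_type_transpose_comp[OF q insert.hyps] by (intro sum.cong) auto
      also have "\<dots> = (\<Sum>j\<in>#?N. real j * of_bool (add_mset (Suc j) (?N - {#j#}) = M))"
        by (rule sum_over_cycles[OF q insert.hyps(1)])
      also have "\<dots> = (\<Sum>j\<in>set_mset ?N \<union> J. ?h j)"
        using finJ by (intro sum_mset_eq_sum_count) auto
      also have "\<dots> = (\<Sum>j\<in>J. ?h j)"
        using finJ by (intro sum.mono_neutral_right) (auto simp: J_def)
      also have "\<dots> = ?rhs"
      proof (rule sum.cong[OF refl])
        fix j assume j: "j \<in> J"
        show "?h j = real j * real (Suc (count M j)) * of_bool (?N = add_mset j (M - {#Suc j#}))"
        proof (cases "j \<in># ?N")
          case True
          then obtain X where X: "?N = add_mset j X" by (auto dest: multi_member_split)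
          obtain Y where Y: "M = add_mset (Suc j) Y" using j by (auto simp: J_def dest: multi_member_split)
          show ?thesis unfolding X Y by auto
        next
          case False
          then show ?thesis by (auto simp: not_in_iff)
        qed
      qed
      finally show ?thesis .
    qed
    \<comment> \<open>Replacing a part \<open>j + 1\<close> by \<open>j\<close> divides the weight
      by \<open>j * (count M j + 1)\<close>, which cancels the number of choices of
      \<open>b\<close>.\<close>
    have step: "real j * real (Suc (count M j)) * N S (add_mset j (M - {#Suc j#})) =
        fact (card S) * cycle_weight M * (real (Suc j) * real (count M (Suc j)))" if "j \<in> J" for j
    proof -
      have j: "j > 0" "Suc j \<in># M" using that by (auto simp: J_def)
      have "N S (add_mset j (M - {#Suc j#})) = fact (card S) * cycle_weight (add_mset j (M - {#Suc j#}))"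
      proof (rule insert.IH)
        show "0 \<notin># add_mset j (M - {#Suc j#})" using insert.prems(1) j by (auto dest: in_diffD)
        show "sum_mset (add_mset j (M - {#Suc j#})) = card S"
          using j card sum_mset.remove[of "Suc j" M] by simp
      qed
      then show ?thesis using j
        by (simp add: cycle_weight_add_mset cycle_weight_remove del: of_nat_Suc)
    qed
    \<comment> \<open>Every permutation of \<open>insert a S\<close> is
      \<open>transpose a b \<circ> q\<close> for exactly one \<open>b\<close> in
      \<open>insert a S\<close> and one \<open>q\<close> permuting \<open>S\<close>.\<close>
    have "N (insert a S) M =
        (\<Sum>b\<in>insert a S. \<Sum>q\<in>?P.
           of_bool (cycle_type (insert a S) (Transposition.transpose a b \<circ> q) = M))"
      unfolding N_def by (rule sum_over_permutations_insert[OF insert.hyps])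
    also have "\<dots> = fact (card S) * cycle_weight M * real (count M 1) +
        (\<Sum>q\<in>?P. \<Sum>b\<in>S. of_bool (cycle_type (insert a S) (Transposition.transpose a b \<circ> q) = M))"
      by (subst sum.insert[OF insert.hyps], subst fixed, subst sum.swap) simp
    also have "(\<Sum>q\<in>?P. \<Sum>b\<in>S. of_bool (cycle_type (insert a S) (Transposition.transpose a b \<circ> q) = M)) =
        (\<Sum>q\<in>?P. \<Sum>j\<in>J. real j * real (Suc (count M j)) *
           of_bool (cycle_type S q = add_mset j (M - {#Suc j#})))"
      using inner by (intro sum.cong) auto
    also have "\<dots> = (\<Sum>j\<in>J. real j * real (Suc (count M j)) * N S (add_mset j (M - {#Suc j#})))"
      unfolding N_def sum_distrib_left by (rule sum.swap)
    also have "\<dots> = (\<Sum>j\<in>J. fact (card S) * cycle_weight M * (real (Suc j) * real (count M (Suc j))))"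
      using step by (intro sum.cong) auto
    also have "\<dots> = fact (card S) * cycle_weight M * (\<Sum>i\<in>Suc ` J. real i * real (count M i))"
      by (simp add: sum_distrib_left sum.reindex)
    also have "fact (card S) * cycle_weight M * real (count M 1) + \<dots> =
        fact (card S) * cycle_weight M * (\<Sum>i\<in>insert 1 (Suc ` J). real i * real (count M i))"
      using finJ by (subst sum.insert) (auto simp: J_def algebra_simps)
    also have "(\<Sum>i\<in>insert 1 (Suc ` J). real i * real (count M i)) = real (\<Sum>i\<in>#M. i)"
    proof -
      have "x \<in> insert 1 (Suc ` J)" if "x \<in># M" for x
        using that insert.prems(1) by (cases x rule: nat.exhaust) (auto simp: J_def image_iff)
      then show ?thesis using finJ
        by (subst sum_mset_eq_sum_count[of "insert 1 (Suc ` J)"]) (auto simp: mult.commute)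
    qed
    finally show ?case using insert.hyps card by (simp add: algebra_simps)
  qed
  moreover have "N S M = real (card {p. p permutes S \<and> cycle_type S p = M})"
    using assms(1) by (simp add: N_def of_bool_def sum.If_cases finite_permutations Collect_conj_eq)
  ultimately show ?thesis by simp
qed

subsection \<open>The coincidence probability as a sum over partitions\<close>

text \<open>Excluding 0 as a part gives each partition a single multiset and keeps the set
  finite.\<close>

definition partitions_of :: "nat \<Rightarrow> nat multiset set" where
  "partitions_of n = {M. 0 \<notin># M \<and> sum_mset M = n}"

lemma member_le_sum_mset: "k \<in># M \<Longrightarrow> k \<le> sum_mset M" for k :: nat
  by (auto dest!: multi_member_split)

lemma set_mset_parts: "M \<in> partitions_of n \<Longrightarrow> set_mset M \<subseteq> {1..n}"
  by (auto simp: partitions_of_def Suc_le_eq dest: member_le_sum_mset intro: gr0I)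

text \<open>Positive parts with sum \<open>n\<close> are at most \<open>n\<close> in number and at
  most \<open>n\<close> in size.\<close>

lemma finite_parts: "finite (partitions_of n)"
proof (rule finite_subset)
  have "size M \<le> sum_mset M" if "0 \<notin># M" for M :: "nat multiset"
    using that by (induction M) auto
  then show "partitions_of n \<subseteq> (\<Union>k\<in>{..n}. multisets_of_size {1..n} k)"
    using set_mset_parts by (force simp: multisets_of_size_def partitions_of_def)
qed (auto intro!: finite_multisets_of_size)

lemma parts_0: "partitions_of 0 = {{#}}"
proof -
  have "M = {#}" if "M \<in> partitions_of 0" for M using that by (cases M) (auto simp: partitions_of_def)
  then show ?thesis by (auto simp: partitions_of_def)
qed

lemma cycle_type_in_parts:
  assumes p: "p permutes S" and S: "finite S"
  shows "cycle_type S p \<in> partitions_of (card S)"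
proof -
  have "card (orbit p x) \<noteq> 0" if "x \<in> S" for x
    using finite_subset[OF permutes_orbit_subset[OF p that] S] orbit_nonempty[of p x] by simp
  then have "0 \<notin># cycle_type S p" using S by (force simp: cycle_type_def)
  then show ?thesis using sum_over_cycles[OF p S, of "\<lambda>_. 1 :: nat"] by (simp add: partitions_of_def)
qed

lemma cycle_structure_eq_count:
  "cycle_structure n p = map (count (cycle_type {1..n} p)) [1..<Suc n]"
  unfolding cycle_structure_def cycle_type_def
  by (intro map_cong refl) (simp add: count_image_mset_eq_card_vimage)

text \<open>The list records multiplicities at 1 to \<open>n\<close> only, but all cycle lengths lie
  in that range.\<close>

lemma cycle_structure_eq_iff:
  assumes "p permutes {1..n}" "q permutes {1..n}"
  shows "cycle_structure n p = cycle_structure n q \<longleftrightarrow> cycle_type {1..n} p = cycle_type {1..n} q"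
proof
  assume eq: "cycle_structure n p = cycle_structure n q"
  have out: "count (cycle_type {1..n} p') j = 0" if "p' permutes {1..n}" "j \<notin> {1..n}" for p' j
    using set_mset_parts[OF cycle_type_in_parts[OF that(1)]] that(2) by (auto simp: count_eq_zero_iff)
  show "cycle_type {1..n} p = cycle_type {1..n} q"
  proof (rule multiset_eqI)
    fix j show "count (cycle_type {1..n} p) j = count (cycle_type {1..n} q) j"
    proof (cases "j \<in> {1..n}")
      case True
      then show ?thesis using eq unfolding cycle_structure_eq_count by auto
    qed (use out assms in auto)
  qed
qed (simp add: cycle_structure_eq_count)

text \<open>Coincidence is the disjoint union over \<open>M\<close> of the events that all
  \<open>r\<close> permutations have type \<open>M\<close>; by independence each has probability the
  \<open>r\<close>-th power of Cauchy's. Permutation 0 serves as the reference, whence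
  \<open>r > 0\<close>.\<close>

lemma W_eq_sum_parts:
  assumes r: "r > 0"
  shows "W r n = (\<Sum>M\<in>partitions_of n. cycle_weight M ^ r)"
proof (cases "n = 0")
  case True
  then show ?thesis by (simp add: W_def parts_0 cycle_weight_def)
next
  case False
  let ?P = "{p. p permutes {1..n}}"
  have fin: "finite ?P" and ne: "?P \<noteq> {}"
    by (auto intro: finite_permutations permutes_id)
  define E where "E = {\<sigma>. \<forall>i<r. \<forall>k<r. cycle_structure n (\<sigma> i) = cycle_structure n (\<sigma> k)}"
  define F where "F M = Pi {..<r} (\<lambda>_. {p. p permutes {1..n} \<and> cycle_type {1..n} p = M})" for M
  have supp: "\<sigma> i permutes {1..n}" if "\<sigma> \<in> set_pmf (random_perms r n)" "i < r" for \<sigma> i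
    using that by (auto simp: random_perms_def set_Pi_pmf PiE_dflt_def set_pmf_of_set[OF ne fin]
        simp del: One_nat_def)
  \<comment> \<open>The events are compared on the support only, where every
    \<open>\<sigma> i\<close> with \<open>i < r\<close> is known to be a permutation.\<close>
  have "E \<inter> set_pmf (random_perms r n) = (\<Union>M\<in>partitions_of n. F M) \<inter> set_pmf (random_perms r n)"
  proof (intro set_eqI iffI)
    fix \<sigma> assume \<sigma>: "\<sigma> \<in> E \<inter> set_pmf (random_perms r n)"
    have "cycle_type {1..n} (\<sigma> i) = cycle_type {1..n} (\<sigma> 0)" if "i < r" for i
    proof -
      have "cycle_structure n (\<sigma> i) = cycle_structure n (\<sigma> 0)"
        using \<sigma> that r unfolding E_def by blast
      then show ?thesis
        using cycle_structure_eq_iff[OF supp[of \<sigma> i] supp[of \<sigma> 0]] \<sigma> that r by blast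
    qed
    then have "\<sigma> i \<in> {p. p permutes {1..n} \<and> cycle_type {1..n} p = cycle_type {1..n} (\<sigma> 0)}"
      if "i < r" for i
      using that supp[of \<sigma> i] \<sigma> by blast
    then have "\<sigma> \<in> F (cycle_type {1..n} (\<sigma> 0))"
      unfolding F_def by (intro Pi_I) (simp only: lessThan_iff)
    moreover have "cycle_type {1..n} (\<sigma> 0) \<in> partitions_of n"
      using cycle_type_in_parts[of "\<sigma> 0" "{1..n}"] supp[of \<sigma> 0] \<sigma> r by auto
    ultimately show "\<sigma> \<in> (\<Union>M\<in>partitions_of n. F M) \<inter> set_pmf (random_perms r n)" using \<sigma> by auto
  next
    fix \<sigma> assume "\<sigma> \<in> (\<Union>M\<in>partitions_of n. F M) \<inter> set_pmf (random_perms r n)"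
    then show "\<sigma> \<in> E \<inter> set_pmf (random_perms r n)"
      by (auto simp: E_def F_def cycle_structure_eq_count Pi_iff)
  qed
  then have "measure_pmf.prob (random_perms r n) E = measure_pmf.prob (random_perms r n) (\<Union>M\<in>partitions_of n. F M)"
    by (metis measure_Int_set_pmf)
  also have "\<dots> = (\<Sum>M\<in>partitions_of n. measure_pmf.prob (random_perms r n) (F M))"
  proof (rule measure_pmf.finite_measure_finite_Union[OF finite_parts])
    have "cycle_type {1..n} (\<sigma> 0) = M" if "\<sigma> \<in> F M" for \<sigma> M
      using that r by (auto simp: F_def Pi_iff)
    then show "disjoint_family_on F (partitions_of n)"
      unfolding disjoint_family_on_def by blast
  qed auto
  also have "\<dots> = (\<Sum>M\<in>partitions_of n. cycle_weight M ^ r)"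
  proof (rule sum.cong[OF refl])
    fix M assume M: "M \<in> partitions_of n"
    have "measure_pmf.prob (pmf_of_set ?P) {p. p permutes {1..n} \<and> cycle_type {1..n} p = M} =
          real (card {p. p permutes {1..n} \<and> cycle_type {1..n} p = M}) / real (card ?P)"
      by (subst measure_pmf_of_set[OF ne fin]) (auto intro!: arg_cong[of _ _ card])
    also have "\<dots> = cycle_weight M"
      using M by (subst card_permutes_cycle_type) (auto simp: partitions_of_def card_permutations[of _ n])
    finally show "measure_pmf.prob (random_perms r n) (F M) = cycle_weight M ^ r"
      unfolding F_def random_perms_def by (subst measure_Pi_pmf_Pi) auto
  qed
  finally show ?thesis using False by (simp add: W_def E_def)
qed

subsection \<open>Bounds for partition sums\<close>

lemma sum_exp_le: "(\<Sum>i\<le>m. x ^ i / fact i) \<le> exp x" if "x \<ge> 0" for x :: real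
proof -
  have "(\<Sum>i\<le>m. x ^ i / fact i) \<le> (\<Sum>i. x ^ i / fact i)"
    using that summable_exp[of x] by (intro sum_le_suminf) (auto simp: field_simps)
  then show ?thesis by (simp add: exp_def field_simps)
qed

text \<open>A multiset over \<open>A\<close> is determined by its multiplicities, so the left side
  is part of the expanded product of the exponential series of the \<open>x j\<close>.\<close>

lemma sum_multisets_le_exp:
  fixes x :: "'a \<Rightarrow> real"
  assumes X: "finite X" and A: "finite A" and sub: "\<And>M. M \<in> X \<Longrightarrow> set_mset M \<subseteq> A"
    and x: "\<And>j. x j \<ge> 0"
  shows "(\<Sum>M\<in>X. \<Prod>j\<in>A. x j ^ count M j / fact (count M j)) \<le> exp (\<Sum>j\<in>A. x j)"
proof -
  \<comment> \<open>A crude common bound for all multiplicities, which truncates the series to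
    finite sums.\<close>
  define m where "m = (\<Sum>M\<in>X. size M)"
  define \<phi> where "\<phi> M = restrict (count M) A" for M :: "'a multiset"
  define f where "f g = (\<Prod>j\<in>A. x j ^ g j / fact (g j))" for g :: "'a \<Rightarrow> nat"
  have le: "count M j \<le> m" if "M \<in> X" for M j
    using count_le_size[of M j] member_le_sum[OF that, of size] X by (auto simp: m_def)
  have inj: "inj_on \<phi> X"
  proof (rule inj_onI, rule multiset_eqI)
    fix M N j assume MN: "M \<in> X" "N \<in> X" "\<phi> M = \<phi> N"
    show "count M j = count N j"
    proof (cases "j \<in> A")
      case True
      then show ?thesis using fun_cong[OF MN(3), of j] by (simp add: \<phi>_def)
    next
      case False
      then have "j \<notin># M" "j \<notin># N" using sub MN by auto
      then show ?thesis by (simp add: not_in_iff)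
    qed
  qed
  have "(\<Sum>M\<in>X. \<Prod>j\<in>A. x j ^ count M j / fact (count M j)) = (\<Sum>M\<in>X. f (\<phi> M))"
    unfolding f_def \<phi>_def by (intro sum.cong prod.cong) auto
  also have "\<dots> = (\<Sum>g\<in>\<phi> ` X. f g)" using inj by (simp add: sum.reindex)
  also have "\<dots> \<le> (\<Sum>g\<in>PiE A (\<lambda>_. {..m}). f g)"
  proof (rule sum_mono2)
    show "\<phi> ` X \<subseteq> PiE A (\<lambda>_. {..m})" using le by (auto simp: \<phi>_def)
    show "f g \<ge> 0" for g unfolding f_def using x by (intro prod_nonneg) auto
  qed (auto intro!: finite_PiE A)
  also have "\<dots> = (\<Prod>j\<in>A. \<Sum>i\<le>m. x j ^ i / fact i)"
    unfolding f_def using A by (intro prod_sum_PiE[symmetric]) auto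
  also have "\<dots> \<le> (\<Prod>j\<in>A. exp (x j))"
    using x by (intro prod_mono) (auto intro!: sum_exp_le sum_nonneg)
  also have "\<dots> = exp (\<Sum>j\<in>A. x j)" using A by (simp add: exp_sum)
  finally show ?thesis .
qed

lemma cycle_weight_nonneg: "cycle_weight M \<ge> 0"
  unfolding cycle_weight_def by (intro prod_nonneg) auto

text \<open>Distribute \<open>\<rho> ^ sum_mset M\<close> over the parts and weaken
  \<open>fact c ^ r\<close> to \<open>fact c\<close>; this leaves exponential series in
  \<open>\<rho> ^ j / j ^ r\<close>.\<close>

lemma sum_cycle_weight_le_exp:
  fixes \<rho> :: real
  assumes X: "finite X" and A: "finite A" and sub: "\<And>M. M \<in> X \<Longrightarrow> set_mset M \<subseteq> A"
    and \<rho>: "\<rho> \<ge> 0" and r: "r > 0"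
  shows "(\<Sum>M\<in>X. cycle_weight M ^ r * \<rho> ^ sum_mset M) \<le> exp (\<Sum>j\<in>A. \<rho> ^ j / real j ^ r)"
proof -
  have "cycle_weight M ^ r * \<rho> ^ sum_mset M \<le>
          (\<Prod>j\<in>A. (\<rho> ^ j / real j ^ r) ^ count M j / fact (count M j))" if M: "M \<in> X" for M
  proof -
    have "sum_mset M = (\<Sum>j\<in>A. count M j * j)"
      using sum_mset_eq_sum_count[OF A sub[OF M], of "\<lambda>j. j"] by simp
    then have "\<rho> ^ sum_mset M = (\<Prod>j\<in>A. \<rho> ^ (count M j * j))" by (simp add: power_sum)
    then have "cycle_weight M ^ r * \<rho> ^ sum_mset M =
        (\<Prod>j\<in>A. (1 / (real j ^ count M j * fact (count M j))) ^ r * \<rho> ^ (count M j * j))"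
      unfolding cycle_weight_superset[OF A sub[OF M]] by (simp add: prod_power_distrib prod.distrib)
    also have "\<dots> \<le> (\<Prod>j\<in>A. (\<rho> ^ j / real j ^ r) ^ count M j / fact (count M j))"
    proof (intro prod_mono conjI)
      fix j
      let ?c = "count M j"
      have "(1 / (real j ^ ?c * fact ?c)) ^ r * \<rho> ^ (?c * j) = (\<rho> ^ j / real j ^ r) ^ ?c / fact ?c ^ r"
        by (simp add: power_divide power_mult_distrib mult.commute flip: power_mult)
      also have "\<dots> \<le> (\<rho> ^ j / real j ^ r) ^ ?c / fact ?c"
        using self_le_power[of "fact ?c :: real" r] r \<rho> by (intro divide_left_mono) (auto simp: fact_ge_1)
      finally show "(1 / (real j ^ ?c * fact ?c)) ^ r * \<rho> ^ (?c * j) \<le> (\<rho> ^ j / real j ^ r) ^ ?c / fact ?c" .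
    qed (use \<rho> in auto)
    finally show ?thesis .
  qed
  then have "(\<Sum>M\<in>X. cycle_weight M ^ r * \<rho> ^ sum_mset M) \<le>
      (\<Sum>M\<in>X. \<Prod>j\<in>A. (\<rho> ^ j / real j ^ r) ^ count M j / fact (count M j))"
    by (rule sum_mono)
  also have "\<dots> \<le> exp (\<Sum>j\<in>A. \<rho> ^ j / real j ^ r)"
    using \<rho> by (intro sum_multisets_le_exp X A sub) auto
  finally show ?thesis .
qed

lemma W_nonneg: "r > 0 \<Longrightarrow> W r n \<ge> 0"
  by (auto simp: W_eq_sum_parts cycle_weight_nonneg intro!: sum_nonneg)

text \<open>The exponential bound with \<open>\<rho> = 1\<close> controls all partial sums at once,
  because the series of \<open>1 / j ^ r\<close> converges for \<open>r \<ge> 2\<close>.\<close>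

lemma summable_W:
  assumes r: "r \<ge> 2"
  shows "summable (W r)"
proof (rule summableI_nonneg_bounded)
  show "0 \<le> W r n" for n using W_nonneg r by simp
  \<comment> \<open>The term at \<open>j = 0\<close> is \<open>1 / 0 = 0\<close>.\<close>
  have s: "summable (\<lambda>j. 1 / real j ^ r)"
    using inverse_power_summable[OF r, where 'a = real] by (simp add: field_simps)
  show "(\<Sum>n<N. W r n) \<le> exp (\<Sum>j. 1 / real j ^ r)" for N
  proof -
    have "(\<Sum>n<N. W r n) = (\<Sum>n<N. \<Sum>M\<in>partitions_of n. cycle_weight M ^ r)"
      using r by (simp add: W_eq_sum_parts)
    also have "\<dots> = (\<Sum>M\<in>(\<Union>n<N. partitions_of n). cycle_weight M ^ r)"
      by (intro sum.UNION_disjoint[symmetric]) (auto simp: finite_parts, auto simp: partitions_of_def)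
    also have "\<dots> = (\<Sum>M\<in>(\<Union>n<N. partitions_of n). cycle_weight M ^ r * 1 ^ sum_mset M)" by simp
    also have "\<dots> \<le> exp (\<Sum>j<N. 1 ^ j / real j ^ r)"
    proof (rule sum_cycle_weight_le_exp)
      show "set_mset M \<subseteq> {..<N}" if "M \<in> (\<Union>n<N. partitions_of n)" for M
        using that set_mset_parts by fastforce
    qed (use r in \<open>auto simp: finite_parts\<close>)
    also have "\<dots> \<le> exp (\<Sum>j. 1 / real j ^ r)"
      using s by (auto intro!: sum_le_suminf)
    finally show ?thesis .
  qed
qed

section \<open>Splitting the partitions of \<open>n\<close> by the size of their parts\<close>

lemma add_mset_in_parts:
  "0 < k \<Longrightarrow> k \<le> n \<Longrightarrow> add_mset k M \<in> partitions_of n \<longleftrightarrow> M \<in> partitions_of (n - k)"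
  by (auto simp: partitions_of_def)

lemma parts_containing:
  assumes "0 < k" "k \<le> n"
  shows "{M \<in> partitions_of n. k \<in># M} = add_mset k ` partitions_of (n - k)"
proof (intro set_eqI iffI)
  fix M assume M: "M \<in> {M \<in> partitions_of n. k \<in># M}"
  then obtain N where "M = add_mset k N" by (auto dest: multi_member_split)
  then show "M \<in> add_mset k ` partitions_of (n - k)" using M assms by (auto simp: add_mset_in_parts)
qed (use assms in \<open>auto simp: add_mset_in_parts\<close>)

text \<open>Adding a part \<open>k\<close> divides the weight by \<open>k\<close> times its new
  multiplicity, which is at least 1.\<close>

lemma sum_parts_containing_le:
  assumes r: "r > 0" and k: "0 < k" "k \<le> n"
  shows "(\<Sum>M | M \<in> partitions_of n \<and> k \<in># M. cycle_weight M ^ r) \<le> W r (n - k) / real k ^ r"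
proof -
  have "(\<Sum>M | M \<in> partitions_of n \<and> k \<in># M. cycle_weight M ^ r) =
        (\<Sum>M\<in>partitions_of (n - k). cycle_weight (add_mset k M) ^ r)"
    using parts_containing[OF k] by (simp add: sum.reindex inj_on_def)
  also have "\<dots> \<le> (\<Sum>M\<in>partitions_of (n - k). (cycle_weight M / real k) ^ r)"
  proof (intro sum_mono power_mono)
    fix M
    show "cycle_weight (add_mset k M) \<le> cycle_weight M / real k"
      using k cycle_weight_nonneg[of M] unfolding cycle_weight_add_mset
      by (intro divide_left_mono) auto
  qed (auto simp: cycle_weight_nonneg)
  also have "\<dots> = W r (n - k) / real k ^ r"
    using r by (simp add: W_eq_sum_parts power_divide sum_divide_distrib)
  finally show ?thesis .
qed

text \<open>A part above \<open>n / 2\<close> is unique and has multiplicity 1. Removing it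
  therefore costs exactly the factor \<open>1 / (n - m)\<close>, where \<open>m\<close> is the sum
  of the other parts, and this gives an equality.\<close>

lemma sum_parts_large_part:
  assumes r: "r > 0" 
  shows "(\<Sum>M | M \<in> partitions_of n \<and> (\<exists>k\<in>#M. n < 2 * k). cycle_weight M ^ r) =
         (\<Sum>m | 2 * m < n. W r m / real (n - m) ^ r)"
proof -
  have fin: "finite {m. 2 * m < n}" by (rule finite_subset[of _ "{..n}"]) auto
  have "(\<Sum>m | 2 * m < n. W r m / real (n - m) ^ r) =
        (\<Sum>m | 2 * m < n. \<Sum>M\<in>partitions_of m. cycle_weight (add_mset (n - m) M) ^ r)"
  proof (rule sum.cong[OF refl])
    fix m assume m: "m \<in> {m. 2 * m < n}"
    have "cycle_weight (add_mset (n - m) M) = cycle_weight M / real (n - m)" if M: "M \<in> partitions_of m" for M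
    proof -
      have "n - m \<notin># M" using M m member_le_sum_mset[of "n - m" M] by (auto simp: partitions_of_def)
      then show ?thesis by (simp add: cycle_weight_add_mset not_in_iff)
    qed
    then show "W r m / real (n - m) ^ r = (\<Sum>M\<in>partitions_of m. cycle_weight (add_mset (n - m) M) ^ r)"
      using r by (simp add: W_eq_sum_parts power_divide sum_divide_distrib)
  qed
  also have "\<dots> = (\<Sum>(m, M)\<in>Sigma {m. 2 * m < n} partitions_of. cycle_weight (add_mset (n - m) M) ^ r)"
    using fin by (intro sum.Sigma) (auto simp: finite_parts)
  also have "\<dots> = (\<Sum>M\<in>(\<Union>m\<in>{m. 2 * m < n}. add_mset (n - m) ` partitions_of m). cycle_weight M ^ r)"
  proof (rule sum.reindex_cong[symmetric])
    show "inj_on (\<lambda>(m, M). add_mset (n - m) M) (Sigma {m. 2 * m < n} partitions_of)"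
    proof (rule inj_onI, clarify)
      fix m M m' M'
      assume *: "2 * m < n" "M \<in> partitions_of m" "2 * m' < n" "M' \<in> partitions_of m'"
        and eq: "add_mset (n - m) M = add_mset (n - m') M'"
      \<comment> \<open>Since \<open>n - m > n / 2 > m'\<close>, this part is too large for
        \<open>M'\<close>; so it must be the added part \<open>n - m'\<close>.\<close>
      have "n - m \<notin># M'" using * member_le_sum_mset[of "n - m" M'] by (auto simp: partitions_of_def)
      moreover have "n - m \<in># add_mset (n - m') M'" by (metis eq union_single_eq_member)
      ultimately have "n - m = n - m'" by auto
      then show "m = m' \<and> M = M'" using eq * by auto
    qed
  qed (auto simp: image_iff)
  also have "(\<Union>m\<in>{m. 2 * m < n}. add_mset (n - m) ` partitions_of m) = {M \<in> partitions_of n. \<exists>k\<in>#M. n < 2 * k}"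
  proof (intro set_eqI iffI)
    fix M assume "M \<in> {M \<in> partitions_of n. \<exists>k\<in>#M. n < 2 * k}"
    then obtain k where k: "M \<in> partitions_of n" "k \<in># M" "n < 2 * k" by auto
    then have "k \<le> n" using set_mset_parts by fastforce
    then have "M \<in> add_mset k ` partitions_of (n - k)" using parts_containing[of k n] k by auto
    then show "M \<in> (\<Union>m\<in>{m. 2 * m < n}. add_mset (n - m) ` partitions_of m)"
      using k \<open>k \<le> n\<close> by (intro UN_I[of "n - k"]) auto
  next
    fix M assume "M \<in> (\<Union>m\<in>{m. 2 * m < n}. add_mset (n - m) ` partitions_of m)"
    then obtain m N where m: "2 * m < n" "N \<in> partitions_of m" "M = add_mset (n - m) N" by auto
    then show "M \<in> {M \<in> partitions_of n. \<exists>k\<in>#M. n < 2 * k}"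
      by (auto simp: add_mset_in_parts intro!: exI[of _ "n - m"])
  qed
  finally show ?thesis by simp
qed

lemma sum_le_sum_over_cover:
  fixes f :: "'a \<Rightarrow> real"
  assumes "finite I" "\<And>i. i \<in> I \<Longrightarrow> finite (B i)" "\<And>x. f x \<ge> 0"
  shows "sum f (\<Union>i\<in>I. B i) \<le> (\<Sum>i\<in>I. sum f (B i))"
  using assms(1,2)
proof (induction I rule: finite_induct)
  case (insert i I)
  have "sum f (\<Union>i\<in>insert i I. B i) \<le> sum f (B i) + sum f (\<Union>i\<in>I. B i)"
    using insert assms(3) by (simp add: sum_Un sum_nonneg)
  then show ?case using insert by simp
qed simp

text \<open>The lower bound keeps only the partitions with a large part. For the upper bound the
  three classes cover all partitions; they may overlap, but all terms are nonnegative.\<close>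

lemma W_split_bounds:
  fixes r K n :: nat
  defines "L \<equiv> (\<Sum>m | 2 * m < n. W r m / real (n - m) ^ r)"
  assumes r: "r > 0"
  shows "L \<le> W r n"
    and "W r n \<le> L + (\<Sum>k\<in>{K<..n div 2}. W r (n - k) / real k ^ r)
           + (\<Sum>M | M \<in> partitions_of n \<and> set_mset M \<subseteq> {1..K}. cycle_weight M ^ r)"
proof -
  let ?f = "\<lambda>M. cycle_weight M ^ r"
  have f0: "?f M \<ge> 0" for M by (simp add: cycle_weight_nonneg)
  let ?Big = "{M \<in> partitions_of n. \<exists>k\<in>#M. n < 2 * k}"
  let ?Mid = "\<Union>k\<in>{K<..n div 2}. {M \<in> partitions_of n. k \<in># M}"
  let ?Small = "{M \<in> partitions_of n. set_mset M \<subseteq> {1..K}}"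
  have fin: "finite ?Big" "finite ?Mid" "finite ?Small" by (auto simp: finite_parts)
  show "L \<le> W r n"
    unfolding L_def sum_parts_large_part[OF r, symmetric] W_eq_sum_parts[OF r, of n]
    by (intro sum_mono2) (auto simp: finite_parts f0)
  have cover: "M \<in> ?Big \<union> ?Mid \<union> ?Small" if M: "M \<in> partitions_of n" for M
  proof (cases "M \<in> ?Small")
    case False
    then obtain k where "k \<in># M" "K < k" using M set_mset_parts[OF M] by fastforce
    then show ?thesis using M by (cases "n < 2 * k") auto
  qed simp
  have "W r n \<le> sum ?f (?Big \<union> ?Mid \<union> ?Small)"
    unfolding W_eq_sum_parts[OF r]
  proof (rule sum_mono2)
    show "finite (?Big \<union> ?Mid \<union> ?Small)" using fin by blast
    show "partitions_of n \<subseteq> ?Big \<union> ?Mid \<union> ?Small" using cover by (rule subsetI)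
  qed (rule f0)
  also have "\<dots> \<le> sum ?f (?Big \<union> ?Mid) + sum ?f ?Small"
    using fin f0 by (subst sum_Un) (auto intro: sum_nonneg)
  also have "sum ?f (?Big \<union> ?Mid) \<le> sum ?f ?Big + sum ?f ?Mid"
    using fin f0 by (subst sum_Un) (auto intro: sum_nonneg)
  also have "sum ?f ?Big = L" unfolding L_def by (rule sum_parts_large_part[OF r])
  also have "sum ?f ?Mid \<le> (\<Sum>k\<in>{K<..n div 2}. sum ?f {M \<in> partitions_of n. k \<in># M})"
    using f0 by (intro sum_le_sum_over_cover) (auto simp: finite_parts)
  also have "\<dots> \<le> (\<Sum>k\<in>{K<..n div 2}. W r (n - k) / real k ^ r)"
    using r by (intro sum_mono sum_parts_containing_le) auto
  finally show "W r n \<le> L + (\<Sum>k\<in>{K<..n div 2}. W r (n - k) / real k ^ r)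
           + (\<Sum>M | M \<in> partitions_of n \<and> set_mset M \<subseteq> {1..K}. cycle_weight M ^ r)"
    by simp
qed

subsection \<open>Asymptotics\<close>

text \<open>This is \<open>1 - t \<le> exp (- t)\<close> multiplied by \<open>exp t\<close>. With
  \<open>t = j * l\<close> it isolates the excess of \<open>\<rho> ^ j\<close> over 1, which carries
  a factor \<open>j\<close>.\<close>

lemma exp_le_one_plus: "exp t \<le> 1 + t * exp t" for t :: real
proof -
  have "(1 - t) * exp t \<le> exp (- t) * exp t"
    using exp_ge_add_one_self[of "- t"] by (intro mult_right_mono) auto
  then show ?thesis by (simp add: algebra_simps flip: exp_add)
qed

text \<open>Rankin's trick: weighting a partition of \<open>n\<close> by \<open>\<rho> ^ n\<close> with \<open>\<rho> = n powr ((r + 1) / n)\<close>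
  gains the factor \<open>n ^ (r + 1)\<close>, while \<open>\<rho> ^ j \<le> sqrt n\<close> for all parts \<open>j \<le> K\<close> keeps the
  exponential bound finite.\<close>
lemma sum_small_parts_le:
  fixes r K n :: nat
  assumes r: "r \<ge> 2" and n: "n > 0" and K: "2 * (r + 1) * K \<le> n"
  shows "real n ^ (r + 1) * (\<Sum>M | M \<in> partitions_of n \<and> set_mset M \<subseteq> {1..K}. cycle_weight M ^ r)
         \<le> exp ((\<Sum>j. 1 / real j ^ r) + real (r + 1) * ln (real n) / sqrt (real n) * harm n)"
proof -
  define l where "l = real (r + 1) * ln (real n) / real n"
  define \<rho> where "\<rho> = exp l"
  have l0: "l \<ge> 0" using n by (simp add: l_def)
  have "\<rho> ^ n = exp (real (r + 1) * ln (real n))"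
    using n by (simp add: \<rho>_def l_def flip: exp_of_nat_mult)
  also have "\<dots> = real n ^ (r + 1)"
    using n by (subst exp_of_nat_mult) simp
  finally have \<rho>n: "\<rho> ^ n = real n ^ (r + 1)" .
  have \<rho>j: "\<rho> ^ j \<le> 1 + real j * (l * sqrt (real n))" if "j \<le> K" for j
  proof -
    have "2 * (r + 1) * j \<le> n"
      using K that by (meson le_trans mult_le_mono2)
    then have "2 * real (r + 1) * real j \<le> real n"
      by (metis of_nat_le_iff of_nat_mult of_nat_numeral)
    then have "real (r + 1) * real j / real n \<le> 1 / 2" using n by (simp add: field_simps)
    then have "real (r + 1) * real j / real n * ln (real n) \<le> 1 / 2 * ln (real n)"
      using n by (intro mult_right_mono) auto
    then have "real j * l \<le> ln (sqrt (real n))"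
      using n by (simp add: l_def ln_sqrt field_simps)
    then have "exp (real j * l) \<le> sqrt (real n)"
      using n by (metis exp_le_cancel_iff exp_ln of_nat_0_less_iff real_sqrt_gt_zero)
    then have "real j * l * exp (real j * l) \<le> real j * l * sqrt (real n)"
      using l0 by (intro mult_left_mono) auto
    then show ?thesis
      using exp_le_one_plus[of "real j * l"] by (simp add: \<rho>_def mult.assoc flip: exp_of_nat_mult)
  qed
  have s: "summable (\<lambda>j. 1 / real j ^ r)"
    using inverse_power_summable[OF r, where 'a = real] by (simp add: field_simps)
  have "K * 1 \<le> K * (2 * (r + 1))" by (intro mult_le_mono2) auto
  then have K_n: "K \<le> n" using K by (simp add: mult.commute)
  have "real n ^ (r + 1) * (\<Sum>M | M \<in> partitions_of n \<and> set_mset M \<subseteq> {1..K}. cycle_weight M ^ r) =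
        (\<Sum>M | M \<in> partitions_of n \<and> set_mset M \<subseteq> {1..K}. cycle_weight M ^ r * \<rho> ^ sum_mset M)"
    unfolding sum_distrib_left by (intro sum.cong refl) (auto simp: partitions_of_def \<rho>n)
  also have "\<dots> \<le> exp (\<Sum>j\<in>{1..K}. \<rho> ^ j / real j ^ r)"
    using r by (intro sum_cycle_weight_le_exp) (auto simp: finite_parts \<rho>_def)
  \<comment> \<open>The 1 in the bound for \<open>\<rho> ^ j\<close> yields the convergent series;
    in the excess, \<open>j / j ^ r \<le> 1 / j\<close> because \<open>r \<ge> 2\<close>, so a
    harmonic number appears.\<close>
  also have "(\<Sum>j\<in>{1..K}. \<rho> ^ j / real j ^ r) \<le> (\<Sum>j\<in>{1..K}. 1 / real j ^ r + l * sqrt (real n) * inverse (real j))"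
  proof (rule sum_mono)
    fix j assume j: "j \<in> {1..K}"
    have "\<rho> ^ j / real j ^ r \<le> (1 + real j * (l * sqrt (real n))) / real j ^ r"
      using \<rho>j[of j] j by (intro divide_right_mono) auto
    also have "\<dots> = 1 / real j ^ r + l * sqrt (real n) * (real j / real j ^ r)"
      by (simp add: add_divide_distrib)
    also have "\<dots> \<le> 1 / real j ^ r + l * sqrt (real n) * inverse (real j)"
    proof (intro add_left_mono mult_left_mono)
      have "real j ^ 2 \<le> real j ^ r" using j r by (intro power_increasing) auto
      then show "real j / real j ^ r \<le> inverse (real j)"
        using j by (simp add: field_simps power2_eq_square)
    qed (use l0 in auto)
    finally show "\<rho> ^ j / real j ^ r \<le> 1 / real j ^ r + l * sqrt (real n) * inverse (real j)" .
  qed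
  also have "\<dots> = (\<Sum>j\<in>{1..K}. 1 / real j ^ r) + l * sqrt (real n) * harm K"
    by (simp add: sum.distrib harm_def sum_distrib_left)
  also have "\<dots> \<le> (\<Sum>j. 1 / real j ^ r) + l * sqrt (real n) * harm n"
    using s l0 K_n by (intro add_mono sum_le_suminf mult_left_mono harm_mono) auto
  also have "l * sqrt (real n) = real (r + 1) * ln (real n) * (sqrt (real n) / real n)"
    by (simp add: l_def)
  also have "sqrt (real n) / real n = inverse (sqrt (real n))" by (rule sqrt_divide_self_eq) simp
  finally show ?thesis by (simp add: divide_inverse)
qed

text \<open>The correction in the exponent is of order \<open>(ln n)^2 / sqrt n\<close>, so the
  exponential stays bounded, and the spare factor \<open>n\<close> of the previous bound gives
  decay.\<close>

lemma sum_small_parts_tendsto_0: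
  assumes r: "r \<ge> 2"
  shows "(\<lambda>n. real n ^ r * (\<Sum>M | M \<in> partitions_of n \<and> set_mset M \<subseteq> {1..n div (2 * (r + 1))}.
           cycle_weight M ^ r))
           \<longlonglongrightarrow> 0" (is "?S \<longlonglongrightarrow> 0")
proof (rule tendsto_sandwich[where f = "\<lambda>_. 0"])
  let ?Z = "\<Sum>j. 1 / real j ^ r"
  let ?u = "\<lambda>n. exp (?Z + real (r + 1) * ln (real n) / sqrt (real n) * (ln (real n) + 1)) / real n"
  show "\<forall>\<^sub>F n in sequentially. ?S n \<le> ?u n"
    using eventually_gt_at_top[of 0]
  proof eventually_elim
    case (elim n)
    \<comment> \<open>The sequence \<open>harm n - ln n\<close> decreases from its value 1 at
      \<open>n = 1\<close>.\<close>
    have harm: "harm n \<le> ln (real n) + 1"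
      using euler_mascheroni_sequence_decreasing[of 1 n] elim by (simp add: harm_expand)
    have "?S n = real n ^ (r + 1) * (\<Sum>M | M \<in> partitions_of n \<and> set_mset M \<subseteq> {1..n div (2 * (r + 1))}.
           cycle_weight M ^ r) / real n"
      using elim by simp
    also have "\<dots> \<le> exp (?Z + real (r + 1) * ln (real n) / sqrt (real n) * harm n) / real n"
      using r elim by (intro divide_right_mono sum_small_parts_le times_div_less_eq_dividend) auto
    also have "\<dots> \<le> ?u n"
      using elim harm
      by (intro divide_right_mono iffD2[OF exp_le_cancel_iff] add_left_mono mult_left_mono) auto
    finally show ?case .
  qed
  have "(\<lambda>n. exp (z + c * ln (real n) / sqrt (real n) * (ln (real n) + 1)) / real n) \<longlonglongrightarrow> 0"
    for z c :: real by real_asymp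
  then show "?u \<longlonglongrightarrow> 0" .
  show "\<forall>\<^sub>F n in sequentially. 0 \<le> ?S n"
    by (intro always_eventually allI mult_nonneg_nonneg sum_nonneg) (auto simp: cycle_weight_nonneg)
qed auto

text \<open>Here \<open>n / k\<close> is at most \<open>2 * (r + 1)\<close>, so the powers cost only
  a constant, while the indices \<open>n - k \<ge> n / 2\<close> run through a tail of a convergent
  series.\<close>

lemma medium_parts_tendsto_0:
  assumes r: "r \<ge> 2"
  shows "(\<lambda>n. real n ^ r * (\<Sum>k\<in>{n div (2 * (r + 1))<..n div 2}. W r (n - k) / real k ^ r)) \<longlonglongrightarrow> 0"
    (is "?S \<longlonglongrightarrow> 0")
proof (rule tendsto_sandwich[where f = "\<lambda>_. 0"])
  let ?c = "real (2 * (r + 1)) ^ r"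
  \<comment> \<open>The block of \<open>W r m\<close> with \<open>n - n div 2 \<le> m < n\<close>,
    as a difference of partial sums with the same limit.\<close>
  let ?u = "\<lambda>n. ?c * ((\<Sum>m<n. W r m) - (\<Sum>m<n - n div 2. W r m))"
  have W0: "W r m \<ge> 0" for m using W_nonneg r by simp
  show "\<forall>\<^sub>F n in sequentially. ?S n \<le> ?u n"
  proof (intro always_eventually allI)
    fix n
    let ?I = "{n div (2 * (r + 1))<..n div 2}"
    have "?S n = (\<Sum>k\<in>?I. (real n / real k) ^ r * W r (n - k))"
      by (simp add: sum_distrib_left power_divide)
    also have "\<dots> \<le> (\<Sum>k\<in>?I. ?c * W r (n - k))"
    proof (intro sum_mono mult_right_mono power_mono W0)
      fix k assume k: "k \<in> ?I"
      then have "n div (2 * (r + 1)) < k" by simp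
      then have "n < k * (2 * (r + 1))" by (subst (asm) div_less_iff_less_mult) auto
      then have "real n \<le> real k * real (2 * (r + 1))" by (metis less_imp_le of_nat_le_iff of_nat_mult)
      then show "real n / real k \<le> real (2 * (r + 1))" using k by (simp add: field_simps)
    qed auto
    also have "\<dots> = ?c * (\<Sum>k\<in>?I. W r (n - k))" by (simp add: sum_distrib_left)
    also have "(\<Sum>k\<in>?I. W r (n - k)) = (\<Sum>m\<in>(\<lambda>k. n - k) ` ?I. W r m)"
      by (subst sum.reindex) (auto intro!: inj_onI)
    also have "\<dots> \<le> (\<Sum>m\<in>{n - n div 2..<n}. W r m)"
      using W0 by (intro sum_mono2) auto
    also have "\<dots> = (\<Sum>m<n. W r m) - (\<Sum>m<n - n div 2. W r m)"
      using sum_diff_nat_ivl[of 0 "n - n div 2" n "W r"] by (simp add: atLeast0LessThan)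
    finally show "?S n \<le> ?u n" by (simp add: mult_left_mono)
  qed
  have lim: "(\<lambda>n. \<Sum>m<n. W r m) \<longlonglongrightarrow> (\<Sum>m. W r m)"
    by (rule summable_LIMSEQ[OF summable_W[OF r]])
  moreover have "filterlim (\<lambda>n. n - n div 2 :: nat) at_top at_top"
    by (rule filterlim_at_top_mono[OF filterlim_at_top_div_const_nat[of 2]])
      (simp, intro always_eventually allI, linarith)
  ultimately have "(\<lambda>n. \<Sum>m<n - n div 2. W r m) \<longlonglongrightarrow> (\<Sum>m. W r m)"
    by (rule filterlim_compose)
  then have "?u \<longlonglongrightarrow> ?c * ((\<Sum>m. W r m) - (\<Sum>m. W r m))" by (intro tendsto_intros lim)
  then show "?u \<longlonglongrightarrow> 0" by simp
  show "\<forall>\<^sub>F n in sequentially. 0 \<le> ?S n"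
    by (intro always_eventually allI mult_nonneg_nonneg sum_nonneg) (auto simp: W0)
qed auto

text \<open>For fixed \<open>m\<close> the ratio \<open>n / (n - m)\<close> tends to 1, and
  \<open>2 * m < n\<close> keeps it at most 2; so Tannery's theorem applies with the summable
  majorant \<open>2 ^ r * W r m\<close>.\<close>

lemma large_part_tendsto:
  assumes r: "r \<ge> 2"
  shows "(\<lambda>n. real n ^ r * (\<Sum>m | 2 * m < n. W r m / real (n - m) ^ r)) \<longlonglongrightarrow> (\<Sum>m. W r m)"
proof -
  \<comment> \<open>Extension by 0 turns the finite sum, whose range grows with \<open>n\<close>,
    into a series over all \<open>m\<close>.\<close>
  define a where "a m n = (if 2 * m < n then W r m * (real n / real (n - m)) ^ r else 0)" for m n
  have W0: "W r m \<ge> 0" for m using W_nonneg r by simp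
  have lim: "(\<lambda>n. a m n) \<longlonglongrightarrow> W r m" for m
  proof (rule Lim_transform_eventually)
    have "(\<lambda>n. real n / (real n - real m)) \<longlonglongrightarrow> 1" by real_asymp
    then have "(\<lambda>n. W r m * (real n / (real n - real m)) ^ r) \<longlonglongrightarrow> W r m * 1 ^ r"
      by (intro tendsto_intros)
    then show "(\<lambda>n. W r m * (real n / (real n - real m)) ^ r) \<longlonglongrightarrow> W r m" by simp
    show "\<forall>\<^sub>F n in sequentially. W r m * (real n / (real n - real m)) ^ r = a m n"
      using eventually_gt_at_top[of "2 * m"] by eventually_elim (simp add: a_def of_nat_diff)
  qed
  have bound: "norm (a m n) \<le> 2 ^ r * W r m" for m n
  proof (cases "2 * m < n")
    case True
    then have "real n / real (n - m) \<le> 2" by (simp add: field_simps of_nat_diff)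
    then have "(real n / real (n - m)) ^ r \<le> 2 ^ r" by (intro power_mono) auto
    then show ?thesis using True W0[of m] by (simp add: a_def mult_left_mono mult.commute)
  qed (use W0 in \<open>simp add: a_def\<close>)
  have "(\<lambda>n. \<Sum>m. a m n) \<longlonglongrightarrow> (\<Sum>m. W r m)"
    using tannerys_theorem[of a "W r" sequentially "\<lambda>m. 2 ^ r * W r m"] lim bound
      summable_mult[OF summable_W[OF r]] by (auto simp: case_prod_unfold)
  moreover have "(\<Sum>m. a m n) = real n ^ r * (\<Sum>m | 2 * m < n. W r m / real (n - m) ^ r)" for n
  proof -
    have fin: "finite {m. 2 * m < n}" by (rule finite_subset[of _ "{..n}"]) auto
    have "(\<Sum>m. a m n) = (\<Sum>m | 2 * m < n. a m n)"
      by (rule suminf_finite[OF fin]) (auto simp: a_def)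
    then show ?thesis by (simp add: a_def sum_distrib_left power_divide mult.commute)
  qed
  ultimately show ?thesis by simp
qed

theorem theoremA1:
  fixes r :: nat
  assumes "r \<ge> 2"
  shows "summable (W r) \<and>
         W r \<sim>[at_top] (\<lambda>n. (\<Sum>m. W r m) / real n ^ r)"
proof
  show sW: "summable (W r)" by (rule summable_W[OF assms])
  let ?A = "\<Sum>m. W r m"
  have W0: "W r m \<ge> 0" for m using W_nonneg assms by simp
  \<comment> \<open>The term \<open>W r 0 = 1\<close> makes the constant positive, so that it can be
    divided by at the end.\<close>
  have "?A \<ge> (\<Sum>m<1. W r m)" using W0 by (intro sum_le_suminf sW) auto
  then have A: "?A > 0" by (simp add: W_def)
  let ?L = "\<lambda>n. \<Sum>m | 2 * m < n. W r m / real (n - m) ^ r"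
  let ?K = "\<lambda>n. n div (2 * (r + 1))"
  let ?M = "\<lambda>n. \<Sum>k\<in>{?K n<..n div 2}. W r (n - k) / real k ^ r"
  let ?S = "\<lambda>n. \<Sum>M | M \<in> partitions_of n \<and> set_mset M \<subseteq> {1..?K n}. cycle_weight M ^ r"
  have "(\<lambda>n. real n ^ r * W r n) \<longlonglongrightarrow> ?A"
  proof (rule tendsto_sandwich)
    show "(\<lambda>n. real n ^ r * ?L n) \<longlonglongrightarrow> ?A" by (rule large_part_tendsto[OF assms])
    have "(\<lambda>n. real n ^ r * ?L n + real n ^ r * ?M n + real n ^ r * ?S n) \<longlonglongrightarrow> ?A + 0 + 0"
      by (intro tendsto_add large_part_tendsto medium_parts_tendsto_0 sum_small_parts_tendsto_0 assms)
    then show "(\<lambda>n. real n ^ r * (?L n + ?M n + ?S n)) \<longlonglongrightarrow> ?A" by (simp add: distrib_left)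
    show "\<forall>\<^sub>F n in sequentially. real n ^ r * ?L n \<le> real n ^ r * W r n"
      using W_split_bounds(1)[of r] assms by (intro always_eventually allI mult_left_mono) auto
    show "\<forall>\<^sub>F n in sequentially. real n ^ r * W r n \<le> real n ^ r * (?L n + ?M n + ?S n)"
      using W_split_bounds(2)[of r] assms by (intro always_eventually allI mult_left_mono) auto
  qed
  then have "(\<lambda>n. real n ^ r * W r n / ?A) \<longlonglongrightarrow> ?A / ?A"
    using A by (intro tendsto_intros) auto
  then show "W r \<sim>[at_top] (\<lambda>n. ?A / real n ^ r)"
    using A by (intro asymp_equivI') (simp add: field_simps)
qed

end
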